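(* For every integer $n\ge 6$, $\mathrm{co}^{+}\mathrm{ex}(n,C_5^{-})=\lfloor n/3\rfloor$.
   Context: A $3$-graph $H$ is a hypergraph all of whose edges have size $3$. For a $2$-set $S$ of vertices, its co-degree is the number of edges of $H$ containing $S$. The minimum positive co-degree $\delta_2^{+}(H)$ of a non-empty $3$-graph $H$ is the minimum co-degree over all $2$-sets $S$ whose co-degree is nonzero. For a $3$-graph $F$, the positive co-degree Turán number $\mathrm{co}^{+}\mathrm{ex}(n,F)$ is the maximum of $\delta_2^{+}(H)$ over all $n$-vertex non-empty $3$-graphs $H$ containing no copy of $F$. $C_5^{-}$ denotes the $3$-graph on vertices $a,b,c,d,e$ with edges $\{abc, bcd, cde, dea\}$. *)

theory Defs
  imports Main
begin

type_synonym 'a hypergraph = "'a set \<times> 'a set set"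

abbreviation verts :: "'a hypergraph \<Rightarrow> 'a set" where
  "verts H \<equiv> fst H"

abbreviation edges :: "'a hypergraph \<Rightarrow> 'a set set" where
  "edges H \<equiv> snd H"

definition three_graph :: "'a hypergraph \<Rightarrow> bool" where
  "three_graph H \<longleftrightarrow> finite (verts H) \<and> (\<forall>e\<in>edges H. e \<subseteq> verts H \<and> card e = 3)"

definition nonempty_graph :: "'a hypergraph \<Rightarrow> bool" where
  "nonempty_graph H \<longleftrightarrow> edges H \<noteq> {}"

definition codegree :: "'a hypergraph \<Rightarrow> 'a set \<Rightarrow> nat" where
  "codegree H S = card {e \<in> edges H. S \<subseteq> e}"

definition min_pos_codegree :: "'a hypergraph \<Rightarrow> nat" where
  "min_pos_codegree H =
     Min {codegree H S | S. S \<subseteq> verts H \<and> card S = 2 \<and> codegree H S \<noteq> 0}"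

text \<open>A copy is a not necessarily induced sub-hypergraph.\<close>

definition contains_copy :: "'a hypergraph \<Rightarrow> 'b hypergraph \<Rightarrow> bool" where
  "contains_copy H F \<longleftrightarrow>
     (\<exists>f. inj_on f (verts F) \<and> f ` verts F \<subseteq> verts H \<and> (\<forall>e\<in>edges F. f ` e \<in> edges H))"

text \<open>Every finite 3-graph is isomorphic to one whose vertices are natural numbers, so it
  suffices to let the host graphs range over vertex sets of type \<^typ>\<open>nat\<close>.\<close>

definition co_plus_ex :: "nat \<Rightarrow> 'b hypergraph \<Rightarrow> nat" where
  "co_plus_ex n F =
     Max {min_pos_codegree H | H :: nat hypergraph.
            three_graph H \<and> card (verts H) = n \<and> nonempty_graph H \<and> \<not> contains_copy H F}"

definition C5_minus :: "nat hypergraph" where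
  "C5_minus = ({0, 1, 2, 3, 4}, {{0, 1, 2}, {1, 2, 3}, {2, 3, 4}, {3, 4, 0}})"

end

theory Submission
  imports Defs
begin

text \<open>
  Lower bound: in the complete balanced tripartite 3-graph, the edges \<open>abc\<close>, \<open>bcd\<close>, \<open>cde\<close> of a
  copy of \<open>C\<^sub>5\<^sup>-\<close> force \<open>a\<close> and \<open>d\<close> into the same part, so \<open>dea\<close> is not an edge.

  Upper bound: suppose that \<open>k\<close> is the minimum positive co-degree and \<open>3k > n\<close>. For an edge
  \<open>abc\<close>, the neighbourhoods of \<open>ab\<close>, \<open>bc\<close>, \<open>ca\<close> are too large to be pairwise disjoint; hence, relabelling, there are
  edges \<open>xab\<close>, \<open>xbc\<close>, \<open>xca\<close>. If a vertex \<open>e\<close> outside \<open>{x, a, b, c}\<close> is a neighbour of \<open>ab\<close>, then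
  being \<open>C\<^sub>5\<^sup>-\<close>-free forbids it to be a neighbour of any other pair in \<open>{x, a, b, c}\<close>. If \<open>abc\<close>
  is not an edge, the outer neighbourhoods of \<open>ab\<close>, \<open>bc\<close>, \<open>ca\<close> are disjoint of size at
  least \<open>k - 1\<close>, so \<open>3(k - 1) \<le> n - 4\<close>. If it is an edge, the same holds for all six pairs with
  \<open>k - 2\<close> in place of \<open>k - 1\<close>, so \<open>6(k - 2) \<le> n - 4\<close>. Both are impossible for \<open>n \<ge> 6\<close>.
\<close>

section \<open>Neighbourhoods of pairs and co-degrees\<close>

definition nbrs :: "'a hypergraph \<Rightarrow> 'a \<Rightarrow> 'a \<Rightarrow> 'a set" where
  "nbrs H u v = {w. {u, v, w} \<in> edges H}"

lemma nbrs_iff: "w \<in> nbrs H u v \<longleftrightarrow> {u, v, w} \<in> edges H"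
  by (simp add: nbrs_def)

lemma three_graph_edgeD:
  assumes "three_graph H" "{u, v, w} \<in> edges H"
  shows "u \<in> verts H" "v \<in> verts H" "w \<in> verts H" "u \<noteq> v" "v \<noteq> w" "u \<noteq> w"
proof -
  have "{u, v, w} \<subseteq> verts H" "card {u, v, w} = 3"
    using assms by (auto simp: three_graph_def)
  then show "u \<in> verts H" "v \<in> verts H" "w \<in> verts H" "u \<noteq> v" "v \<noteq> w" "u \<noteq> w"
    by (auto simp: card_insert_if split: if_splits)
qed

lemma nbrs_subset_verts: "three_graph H \<Longrightarrow> nbrs H u v \<subseteq> verts H"
  by (auto simp: nbrs_iff dest: three_graph_edgeD)

lemma finite_nbrs: "three_graph H \<Longrightarrow> finite (nbrs H u v)"
  by (meson finite_subset nbrs_subset_verts three_graph_def)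

text \<open>Sending \<open>w\<close> to \<open>{u, v, w}\<close> is a bijection onto the edges
  through the pair. It breaks down for \<open>u = v\<close>: \<open>nbrs H u u\<close> is empty,
  while \<open>{u}\<close> may lie in edges.\<close>

lemma codegree_pair:
  assumes H: "three_graph H" and "u \<noteq> v"
  shows "codegree H {u, v} = card (nbrs H u v)"
proof -
  have "bij_betw (\<lambda>w. {u, v, w}) (nbrs H u v) {e \<in> edges H. {u, v} \<subseteq> e}"
  proof (rule bij_betw_imageI)
    show "inj_on (\<lambda>w. {u, v, w}) (nbrs H u v)"
    proof (rule inj_onI)
      fix w z assume "w \<in> nbrs H u v" "z \<in> nbrs H u v" "{u, v, w} = {u, v, z}"
      then show "w = z"
        using three_graph_edgeD[OF H, of u v w] three_graph_edgeD[OF H, of u v z]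
        by (auto simp: nbrs_iff insert_eq_iff doubleton_eq_iff)
    qed
    show "(\<lambda>w. {u, v, w}) ` nbrs H u v = {e \<in> edges H. {u, v} \<subseteq> e}"
    proof (intro equalityI subsetI)
      fix e assume e: "e \<in> {e \<in> edges H. {u, v} \<subseteq> e}"
      then have "card e = 3" "finite e"
        using H by (auto simp: three_graph_def intro: finite_subset)
      then have "card (e - {u, v}) = 1"
        using e \<open>u \<noteq> v\<close> by (simp add: card_Diff_subset)
      then obtain w where "e - {u, v} = {w}"
        by (auto simp: card_1_singleton_iff)
      then have "e = {u, v, w}"
        using e by auto
      then show "e \<in> (\<lambda>w. {u, v, w}) ` nbrs H u v"
        using e by (auto simp: nbrs_iff)
    qed (auto simp: nbrs_iff)
  qed
  then show ?thesis
    by (simp add: codegree_def bij_betw_same_card)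
qed

lemma min_pos_codegree_le:
  assumes H: "three_graph H" and e: "{u, v, w} \<in> edges H"
  shows "min_pos_codegree H \<le> card (nbrs H u v)"
proof -
  have "card (nbrs H u v) \<noteq> 0"
    using e finite_nbrs[OF H] by (auto simp: nbrs_iff)
  moreover have "finite {codegree H S | S. S \<subseteq> verts H \<and> card S = 2 \<and> codegree H S \<noteq> 0}"
    using H by (simp add: three_graph_def)
  ultimately show ?thesis
    unfolding min_pos_codegree_def using three_graph_edgeD[OF H e]
    by (intro Min_le) (auto simp flip: codegree_pair[OF H] intro!: exI[of _ "{u, v}"])
qed

lemma min_pos_codegree_ge:
  assumes H: "three_graph H" and "nonempty_graph H"
    and k: "\<And>u v w. {u, v, w} \<in> edges H \<Longrightarrow> k \<le> card (nbrs H u v)"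
  shows "k \<le> min_pos_codegree H"
proof -
  let ?D = "{codegree H S | S. S \<subseteq> verts H \<and> card S = 2 \<and> codegree H S \<noteq> 0}"
  \<comment> \<open>\<open>Min\<close> is unspecified on the empty set, so an edge is used to
    exhibit a member of \<open>?D\<close>.\<close>
  obtain e where "e \<in> edges H" "card e = 3"
    using assms by (auto simp: nonempty_graph_def three_graph_def)
  then obtain u v w where e: "{u, v, w} \<in> edges H"
    by (auto simp: card_3_iff)
  have "codegree H {u, v} = card (nbrs H u v)"
    using codegree_pair[OF H] three_graph_edgeD[OF H e] by simp
  moreover have "card (nbrs H u v) \<noteq> 0"
    using e finite_nbrs[OF H] by (auto simp: nbrs_iff)
  ultimately have "codegree H {u, v} \<in> ?D"
    using three_graph_edgeD[OF H e] by (auto intro!: exI[of _ "{u, v}"])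
  moreover have "finite ?D"
    using H by (simp add: three_graph_def)
  moreover have "k \<le> d" if d_in: "d \<in> ?D" for d
  proof -
    obtain S where S: "d = codegree H S" "card S = 2" "codegree H S \<noteq> 0"
      using d_in by blast
    then obtain p q where pq: "S = {p, q}" "p \<noteq> q"
      by (auto simp: card_2_iff)
    then have d: "d = card (nbrs H p q)" "card (nbrs H p q) \<noteq> 0"
      using S codegree_pair[OF H] by auto
    then obtain r where "r \<in> nbrs H p q"
      by (metis card.empty ex_in_conv)
    then show ?thesis
      using k d by (auto simp: nbrs_iff)
  qed
  ultimately show ?thesis
    unfolding min_pos_codegree_def by (subst Min_ge_iff) auto
qed

section \<open>Copies of C_5^- and outer neighbours of a K_4^-\<close>

lemma contains_copy_C5_minus_iff:
  assumes H: "three_graph H"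
  shows "contains_copy H C5_minus \<longleftrightarrow>
    (\<exists>a b c d e. distinct [a, b, c, d, e] \<and> {a, b, c} \<in> edges H \<and> {b, c, d} \<in> edges H \<and>
      {c, d, e} \<in> edges H \<and> {d, e, a} \<in> edges H)"
    (is "_ \<longleftrightarrow> ?R")
proof
  assume "contains_copy H C5_minus"
  then obtain f where f: "inj_on f {0, 1, 2, 3, 4::nat}" "{f 0, f 1, f 2} \<in> edges H"
      "{f 1, f 2, f 3} \<in> edges H" "{f 2, f 3, f 4} \<in> edges H" "{f 3, f 4, f 0} \<in> edges H"
    by (auto simp: contains_copy_def C5_minus_def)
  moreover have "distinct [f 0, f 1, f 2, f 3, f 4]"
    using f(1) by (auto simp: inj_on_def)
  ultimately show ?R by blast
next
  assume ?R
  then obtain a b c d e where *: "distinct [a, b, c, d, e]" "{a, b, c} \<in> edges H"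
      "{b, c, d} \<in> edges H" "{c, d, e} \<in> edges H" "{d, e, a} \<in> edges H"
    by blast
  let ?f = "\<lambda>i. [a, b, c, d, e] ! i"
  have "inj_on ?f {0, 1, 2, 3, 4}"
    using *(1) by (intro inj_on_nth) auto
  \<comment> \<open>The edges \<open>abc\<close> and \<open>cde\<close> already cover all five
    vertices.\<close>
  moreover have "?f ` {0, 1, 2, 3, 4} \<subseteq> verts H"
    using three_graph_edgeD[OF H *(2)] three_graph_edgeD[OF H *(4)] by auto
  ultimately show "contains_copy H C5_minus"
    unfolding contains_copy_def C5_minus_def using *
    by (intro exI[of _ ?f]) auto
qed

text \<open>A second pair with neighbour \<open>e\<close> would close a copy of C_5^-, whose vertex
  order is the instance of \<open>no\<close>. If the pair meets \<open>ab\<close>, two edges at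
  \<open>x\<close> come first and the two edges at \<open>e\<close> last; for the opposite pair
  \<open>xc\<close> the edges at \<open>e\<close> are the two ends.\<close>

lemma C5_minus_free_link:
  assumes H: "three_graph H" and free: "\<not> contains_copy H C5_minus"
    and "distinct [x, a, b, c, e]"
    and "{x, a, b} \<in> edges H" "{x, b, c} \<in> edges H" "{x, c, a} \<in> edges H" "{a, b, e} \<in> edges H"
  shows "{b, c, e} \<notin> edges H" "{a, c, e} \<notin> edges H" "{x, a, e} \<notin> edges H"
    "{x, b, e} \<notin> edges H" "{x, c, e} \<notin> edges H"
proof -
  have no: False if "distinct [p, q, r, s, t]" "{p, q, r} \<in> edges H" "{q, r, s} \<in> edges H"
    "{r, s, t} \<in> edges H" "{s, t, p} \<in> edges H" for p q r s t
    using free that unfolding contains_copy_C5_minus_iff[OF H] by blast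
  show "{b, c, e} \<notin> edges H"
    using no[of a x c b e] assms by (auto simp: insert_commute)
  show "{a, c, e} \<notin> edges H"
    using no[of b x c a e] assms by (auto simp: insert_commute)
  show "{x, a, e} \<notin> edges H"
    using no[of b c x a e] assms by (auto simp: insert_commute)
  show "{x, b, e} \<notin> edges H"
    using no[of a c x b e] assms by (auto simp: insert_commute)
  show "{x, c, e} \<notin> edges H"
    using no[of e a b x c] assms by (auto simp: insert_commute)
qed

text \<open>Deleting \<open>{x, a, b, c}\<close> makes a common neighbour a fifth vertex, as the
  link lemma demands.\<close>

lemma C5_minus_free_nbrs_disjoint:
  assumes "three_graph H" "\<not> contains_copy H C5_minus" "distinct [x, a, b, c]"
    and "{x, a, b} \<in> edges H" "{x, b, c} \<in> edges H" "{x, c, a} \<in> edges H"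
  defines "M \<equiv> \<lambda>u v. nbrs H u v - {x, a, b, c}"
  shows "M a b \<inter> M b c = {}" "M a b \<inter> M a c = {}" "M a b \<inter> M x a = {}"
    "M a b \<inter> M x b = {}" "M a b \<inter> M x c = {}"
  using C5_minus_free_link[OF assms(1,2), of x a b c] assms(3-6)
  by (auto simp: M_def nbrs_iff)

section \<open>Upper bound: counting outer neighbours\<close>

lemma card_Un3_disjoint:
  assumes "finite A" "finite B" "finite C" "A \<inter> B = {}" "A \<inter> C = {}" "B \<inter> C = {}"
  shows "card (A \<union> B \<union> C) = card A + card B + card C"
  using assms by (simp add: card_Un_disjoint Int_Un_distrib2)

lemma min_pos_codegree_C5_minus_free_K4_minus_le:
  assumes H: "three_graph H" and free: "\<not> contains_copy H C5_minus" and n: "card (verts H) \<ge> 6"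
    and e: "{x, a, b} \<in> edges H" "{x, b, c} \<in> edges H" "{x, c, a} \<in> edges H"
  shows "3 * min_pos_codegree H \<le> card (verts H)"
proof -
  let ?K = "{x, a, b, c}"
  define M where "M = (\<lambda>u v. nbrs H u v - ?K)"
  let ?k = "min_pos_codegree H" and ?n = "card (verts H)"
  note D = three_graph_edgeD[OF H e(1)] three_graph_edgeD[OF H e(2)] three_graph_edgeD[OF H e(3)]
  have dist: "distinct [x, a, b, c]"
    using D by auto
  have fin: "finite (M u v)" for u v
    by (simp add: M_def finite_nbrs[OF H])
  have outside: "card (verts H - ?K) = ?n - 4"
    using D dist by (subst card_Diff_subset) auto
  have bound: "card A \<le> ?n - 4" if "A \<subseteq> verts H - ?K" for A
    using card_mono[OF _ that] H outside by (simp add: three_graph_def)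
  have sub: "M u v \<subseteq> verts H - ?K" for u v
    using nbrs_subset_verts[OF H] by (auto simp: M_def)
  \<comment> \<open>\<open>R\<close> collects the possible neighbours inside \<open>?K\<close>; its
    size is the loss in passing from \<open>nbrs\<close> to \<open>M\<close>.\<close>
  have deg: "?k \<le> card (M u v) + card R"
    if "{u, v, w} \<in> edges H" "nbrs H u v \<inter> ?K \<subseteq> R" "finite R" for u v w R
  proof -
    have "nbrs H u v \<subseteq> M u v \<union> R"
      using that by (auto simp: M_def)
    then have "card (nbrs H u v) \<le> card (M u v \<union> R)"
      by (intro card_mono) (auto simp: fin that)
    then show ?thesis
      using min_pos_codegree_le[OF H that(1)] card_Un_le[of "M u v" R] by linarith
  qed
  have nself: "u \<notin> nbrs H u v" "v \<notin> nbrs H u v" for u v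
    using three_graph_edgeD[OF H, of u v u] three_graph_edgeD[OF H, of u v v]
    by (auto simp: nbrs_iff)
  have comm: "M u v = M v u" for u v
    by (simp add: M_def nbrs_def insert_commute)
  \<comment> \<open>Only the set \<open>?K\<close> is fixed here, so any vertex whose three edges
    inside \<open>?K\<close> are present can serve as the apex \<open>y\<close>.\<close>
  have disj: "M p q \<inter> M q r = {} \<and> M p q \<inter> M p r = {} \<and> M p q \<inter> M y p = {} \<and>
      M p q \<inter> M y q = {} \<and> M p q \<inter> M y r = {}"
    if "distinct [y, p, q, r]" "{y, p, q, r} = ?K" "{y, p, q} \<in> edges H" "{y, q, r} \<in> edges H"
      "{y, r, p} \<in> edges H" for y p q r
    using C5_minus_free_nbrs_disjoint[OF H free that(1,3,4,5)] that(2) by (simp add: M_def)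
  have ab: "M a b \<inter> M b c = {}" "M a b \<inter> M a c = {}" "M a b \<inter> M x a = {}"
      "M a b \<inter> M x b = {}" "M a b \<inter> M x c = {}"
    using disj[OF dist refl e] by blast+
  \<comment> \<open>With apex \<open>x\<close> kept, \<open>bc\<close> and \<open>ac\<close> in turn
    take the role of \<open>ab\<close>.\<close>
  have "{x, b, c, a} = ?K" "{x, a, c, b} = ?K" by auto
  moreover have "{x, a, c} \<in> edges H" "{x, c, b} \<in> edges H" "{x, b, a} \<in> edges H"
    using e by (simp_all add: insert_commute)
  ultimately have bc: "M b c \<inter> M x a = {}" "M b c \<inter> M x b = {}" "M b c \<inter> M x c = {}"
    and ac: "M a c \<inter> M x a = {}" "M a c \<inter> M x b = {}" "M a c \<inter> M x c = {}"
      "M b c \<inter> M a c = {}"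
    using disj[of x b c a] disj[of x a c b] e dist comm[of c b] by (auto simp del: Int_iff)
  have abc_le: "card (M a b) + card (M b c) + card (M a c) \<le> ?n - 4"
    using bound[of "M a b \<union> M b c \<union> M a c"] sub ab ac(4)
    by (simp add: card_Un3_disjoint fin)
  show ?thesis
  proof (cases "{a, b, c} \<in> edges H")
    case False
    then have "nbrs H a b \<inter> ?K \<subseteq> {x}" "nbrs H b c \<inter> ?K \<subseteq> {x}" "nbrs H a c \<inter> ?K \<subseteq> {x}"
      using nself by (auto simp: nbrs_iff insert_commute)
    then have "?k \<le> card (M a b) + 1" "?k \<le> card (M b c) + 1" "?k \<le> card (M a c) + 1"
      using deg[of a b x "{x}"] deg[of b c x "{x}"] deg[of a c x "{x}"] e
      by (auto simp: insert_commute)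
    then show ?thesis
      using abc_le n by linarith
  next
    case True
    \<comment> \<open>Both remaining vertices \<open>p\<close>, \<open>q\<close> of
      \<open>?K\<close> may now be neighbours, hence the loss of 2.\<close>
    have deg2: "?k \<le> card (M u v) + 2"
      if "{u, v, p} \<in> edges H" "{p, q, u, v} = ?K" for u v p q
    proof -
      have "nbrs H u v \<inter> ?K \<subseteq> {p, q}"
        unfolding that(2)[symmetric] using nself by auto
      then have "?k \<le> card (M u v) + card {p, q}"
        by (intro deg[OF that(1)]) simp_all
      moreover have "card {p, q} \<le> 2"
        by (simp add: card_insert_if)
      ultimately show ?thesis by linarith
    qed
    have e': "{a, b, x} \<in> edges H" "{b, c, x} \<in> edges H" "{a, c, x} \<in> edges H"
      "{b, x, a} \<in> edges H" "{b, a, c} \<in> edges H" "{b, c, x} \<in> edges H"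
      "{a, x, b} \<in> edges H" "{x, b, a} \<in> edges H" "{x, c, b} \<in> edges H"
      using e True by (simp_all add: insert_commute)
    have k: "?k \<le> card (M a b) + 2" "?k \<le> card (M b c) + 2" "?k \<le> card (M a c) + 2"
      "?k \<le> card (M x a) + 2" "?k \<le> card (M x b) + 2" "?k \<le> card (M x c) + 2"
      by (rule deg2[OF e'(1), of c] deg2[OF e'(2), of a] deg2[OF e'(3), of b]
        deg2[OF e(1), of c] deg2[OF e'(8), of c] deg2[OF e'(9), of a]; auto)+
    \<comment> \<open>With \<open>abc\<close> present, \<open>b\<close> and \<open>a\<close> are
      also apexes, which separates the pairs through \<open>x\<close> from each other.\<close>
    have "distinct [b, x, a, c]" "distinct [a, x, b, c]" "{b, x, a, c} = ?K" "{a, x, b, c} = ?K"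
      using dist by auto
    then have star: "M x a \<inter> M x b = {}" "M x a \<inter> M x c = {}" "M x b \<inter> M x c = {}"
      using disj[of b x a c] disj[of a x b c] e' True comm[of b x] by simp_all
    have cross: "(M a b \<union> M b c \<union> M a c) \<inter> (M x a \<union> M x b \<union> M x c) = {}"
      unfolding Int_Un_distrib Int_Un_distrib2 using ab bc ac by simp
    have "card (M a b) + card (M b c) + card (M a c) + (card (M x a) + card (M x b) + card (M x c))
      = card ((M a b \<union> M b c \<union> M a c) \<union> (M x a \<union> M x b \<union> M x c))"
      using cross star ab ac(4) by (subst card_Un_disjoint) (simp_all add: card_Un3_disjoint fin)
    also have "\<dots> \<le> ?n - 4"
      using sub by (intro bound) simp
    finally have "6 * ?k \<le> ?n + 8"
      using k n by linarith
    \<comment> \<open>For n >= 8, n + 8 <= 2n suffices; for n = 6 and n = 7 integrality gives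
      \<open>?k\<close> <= 2.\<close>
    then show ?thesis
      using n by presburger
  qed
qed

lemma min_pos_codegree_C5_minus_free_le:
  assumes H: "three_graph H" and free: "\<not> contains_copy H C5_minus" and n: "card (verts H) \<ge> 6"
    and "nonempty_graph H"
  shows "min_pos_codegree H \<le> card (verts H) div 3"
proof -
  obtain e where "e \<in> edges H" "card e = 3"
    using assms by (auto simp: nonempty_graph_def three_graph_def)
  then obtain a b c where e: "{a, b, c} \<in> edges H"
    by (auto simp: card_3_iff)
  let ?A = "nbrs H a b" and ?B = "nbrs H b c" and ?C = "nbrs H a c"
  note K = min_pos_codegree_C5_minus_free_K4_minus_le[OF H free n]
  have "3 * min_pos_codegree H \<le> card (verts H)"
  proof (cases "?A \<inter> ?B = {} \<and> ?A \<inter> ?C = {} \<and> ?B \<inter> ?C = {}")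
    case True
    have "min_pos_codegree H \<le> card ?A" "min_pos_codegree H \<le> card ?B"
      "min_pos_codegree H \<le> card ?C"
      using min_pos_codegree_le[OF H, of a b c] min_pos_codegree_le[OF H, of b c a]
        min_pos_codegree_le[OF H, of a c b] e by (auto simp: insert_commute)
    moreover have "card ?A + card ?B + card ?C = card (?A \<union> ?B \<union> ?C)"
      using True by (simp add: card_Un3_disjoint finite_nbrs[OF H])
    moreover have "\<dots> \<le> card (verts H)"
      using H nbrs_subset_verts[OF H] by (intro card_mono) (auto simp: three_graph_def)
    ultimately show ?thesis by linarith
  next
    case False
    then consider d where "d \<in> ?A" "d \<in> ?B" | d where "d \<in> ?A" "d \<in> ?C"
      | d where "d \<in> ?B" "d \<in> ?C" by blast
    then show ?thesis
    proof cases
      \<comment> \<open>In each case the apex is the common vertex of the two pairs that have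
        \<open>d\<close> as a neighbour.\<close>
      case (1 d) then show ?thesis
        using K[of b a c d] e by (auto simp: nbrs_iff insert_commute)
    next
      case (2 d) then show ?thesis
        using K[of a b c d] e by (auto simp: nbrs_iff insert_commute)
    next
      case (3 d) then show ?thesis
        using K[of c a b d] e by (auto simp: nbrs_iff insert_commute)
    qed
  qed
  then show ?thesis by linarith
qed

section \<open>Lower bound: the tripartite 3-graph on the residue classes modulo 3\<close>

definition tripartite3 :: "nat \<Rightarrow> nat hypergraph" where
  "tripartite3 n = ({..<n}, {e. e \<subseteq> {..<n} \<and> card e = 3 \<and> inj_on (\<lambda>i. i mod 3) e})"

lemma three_graph_tripartite3: "three_graph (tripartite3 n)"
  by (simp add: tripartite3_def three_graph_def)

lemma tripartite3_edge_iff: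
  "{u, v, w} \<in> edges (tripartite3 n) \<longleftrightarrow> u < n \<and> v < n \<and> w < n \<and>
    u mod 3 \<noteq> v mod 3 \<and> v mod 3 \<noteq> w mod 3 \<and> u mod 3 \<noteq> w mod 3"
  by (auto simp: tripartite3_def card_insert_if split: if_splits)

text \<open>Applied to residues: the parts of two vertices of an edge determine the part of the
  third.\<close>

lemma less_3_eq_third:
  fixes p q r s :: nat
  assumes "p < 3" "q < 3" "r < 3" "s < 3" "p \<noteq> q" "q \<noteq> r" "p \<noteq> r" "p \<noteq> s" "q \<noteq> s"
  shows "r = s"
  using assms by linarith

lemma tripartite3_C5_minus_free: "\<not> contains_copy (tripartite3 n) C5_minus"
proof
  assume "contains_copy (tripartite3 n) C5_minus"
  then obtain a b c d e where "{a, b, c} \<in> edges (tripartite3 n)" "{b, c, d} \<in> edges (tripartite3 n)"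
      "{c, d, e} \<in> edges (tripartite3 n)" "{d, e, a} \<in> edges (tripartite3 n)"
    unfolding contains_copy_C5_minus_iff[OF three_graph_tripartite3] by blast
  then show False
    unfolding tripartite3_edge_iff using less_3_eq_third[of "b mod 3" "c mod 3" "a mod 3" "d mod 3"]
    by (metis mod_less_divisor zero_less_numeral)
qed

lemma tripartite3_nonempty:
  assumes "n \<ge> 3"
  shows "nonempty_graph (tripartite3 n)"
proof -
  have "{0, 1, 2} \<in> edges (tripartite3 n)"
    using assms unfolding tripartite3_edge_iff by simp
  then show ?thesis by (auto simp: nonempty_graph_def)
qed

lemma min_pos_codegree_tripartite3_ge:
  assumes "n \<ge> 3"
  shows "n div 3 \<le> min_pos_codegree (tripartite3 n)"
proof (rule min_pos_codegree_ge[OF three_graph_tripartite3 tripartite3_nonempty[OF assms]])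
  fix u v w assume e: "{u, v, w} \<in> edges (tripartite3 n)"
  \<comment> \<open>Every vertex in the part of \<open>w\<close> is a neighbour of
    \<open>uv\<close>. The listed ones are below \<open>3 * (n div 3)\<close>, hence below
    \<open>n\<close>.\<close>
  have "(\<lambda>i. 3 * i + w mod 3) ` {..<n div 3} \<subseteq> nbrs (tripartite3 n) u v"
  proof
    fix z assume "z \<in> (\<lambda>i. 3 * i + w mod 3) ` {..<n div 3}"
    then obtain i where i: "z = 3 * i + w mod 3" "i < n div 3" by auto
    have "w mod 3 < 3" "3 * (n div 3) \<le> n" by simp_all
    then have "z < n" "z mod 3 = w mod 3"
      using i by simp_all
    then show "z \<in> nbrs (tripartite3 n) u v"
      using e unfolding nbrs_iff tripartite3_edge_iff by simp
  qed
  then have "card ((\<lambda>i. 3 * i + w mod 3) ` {..<n div 3}) \<le> card (nbrs (tripartite3 n) u v)"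
    by (intro card_mono finite_nbrs three_graph_tripartite3)
  then show "n div 3 \<le> card (nbrs (tripartite3 n) u v)"
    by (simp add: card_image inj_on_def)
qed

theorem theorem1:
  fixes n :: nat
  assumes "n \<ge> 6"
  shows "co_plus_ex n C5_minus = n div 3"
proof -
  let ?V = "{min_pos_codegree H | H :: nat hypergraph.
    three_graph H \<and> card (verts H) = n \<and> nonempty_graph H \<and> \<not> contains_copy H C5_minus}"
  have upper: "d \<le> n div 3" if "d \<in> ?V" for d
    using that min_pos_codegree_C5_minus_free_le assms by auto
  have card: "card (verts (tripartite3 n)) = n"
    by (simp add: tripartite3_def)
  then have "min_pos_codegree (tripartite3 n) \<in> ?V"
    using assms three_graph_tripartite3 tripartite3_nonempty tripartite3_C5_minus_free
    by fastforce
  moreover from this have "min_pos_codegree (tripartite3 n) = n div 3"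
    using upper min_pos_codegree_tripartite3_ge assms by (intro antisym) auto
  ultimately have "n div 3 \<in> ?V" by simp
  \<comment> \<open>Infinitely many graphs on \<open>nat\<close> qualify; finiteness, needed for
    \<open>Max\<close>, comes from the upper bound on the values.\<close>
  moreover have "finite ?V"
    using upper by (intro finite_subset[of ?V "{..n div 3}"]) auto
  ultimately show ?thesis
    unfolding co_plus_ex_def using upper by (intro Max_eqI) auto
qed

end
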